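(* Let $s\ge2$, $2\le w<r<\overline{n}$, $N=w^{\overline{n}}$, $n=s\overline{n}$, $k=n-r$, and let $\mathbf{F}_q$ be a finite field with $q>\lceil\frac{s}{w}\rceil w\overline{n}$ and primitive element $c$. For $u\in[0:w)$ and $i=zw\overline{n}+y\overline{n}+\bar i\in[0:n)$ with $z\in[0:\lceil\frac{s}{w}\rceil)$, $y\in[0:w)$, $\bar i\in[0:\overline{n})$, set $$\xi'_{i,u}=c^{\,zw\overline{n}+\bar iw+(u\oplus_w y)} .$$ Then the $(n,k)$ array code $\mathcal{C}_2'$ over $\mathbf{F}_q$ with sub-packetization level $N$ and parity-check matrix $(A_i^t)_{t\in[0:r),i\in[0:n)}$, where $$A_i=\sum_{a=0}^{N-1}\xi'_{i,a_{\bar i}}e_a^\top e_a,$$ is an MDS array code with the $(d=k+w-1,\,d_c=s-1)$-repair property and $\bigl(1+\frac{d_c(d-k)}{d}\bigr)$-optimal repair bandwidth.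
   Context: Notation: $[a:b)=\{a,\dots,b-1\}$; $\oplus_w$ is addition modulo $w$ (with values in $[0:w)$); $A^0=I$. $e_0,\dots,e_{N-1}$ are the standard basis row vectors of $\mathbf{F}_q^N$; for $a\in[0:N)$, $(a_0,\dots,a_{\overline{n}-1})$ is its $w$-ary expansion with $a_0$ most significant. Array codes: an $(n,k)$ array code with parity-check matrix $(A_{t,i})_{t\in[0:r),i\in[0:n)}$ ($r=n-k$, $A_{t,i}\in\mathbf{F}_q^{N\times N}$) is the set of $(\mathbf{f}_0,\dots,\mathbf{f}_{n-1})$, $\mathbf{f}_i\in\mathbf{F}_q^N$ columns, with $\sum_iA_{t,i}\mathbf{f}_i=0$ for all $t\in[0:r)$. It is MDS if every $r\times r$ sub-block matrix $(A_{t,i_j})_{t,j\in[0:r)}$, $i_0<\dots<i_{r-1}$, is non-singular (any $k$ nodes determine the codeword). $(d,d_c)$-repair property with $(1+\epsilon)$-optimal repair bandwidth: for every node $i$ there are a set of $d_c$ compulsory helper nodes and full-rank repair matrices $R_{i,j}$ ($j\neq i$, each with $N$ columns) such that for every $d$-subset $H_i\subseteq[0:n)\setminus\{i\}$ containing the compulsory helper nodes, $\mathbf{f}_i$ can be recovered from the data $R_{i,j}\mathbf{f}_j$, $j\in H_i$, and $\sum_{j\in H_i}\operatorname{rank}(R_{i,j})\le(1+\epsilon)\frac{d}{d-k+1}N$. *)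

theory Defs
  imports Complex_Main "HOL-Library.FuncSet" "HOL-Library.Cardinality" "Jordan_Normal_Form.DL_Rank"
begin

text \<open>
  The finite field \<open>F\<^sub>q\<close> is a type of class \<open>{field, finite}\<close>, with \<open>q = CARD('a)\<close>.
  A matrix with \<open>n\<close> columns of \<open>N \<times> N\<close> blocks is given by the function \<open>A\<close> sending the block
  position \<open>(t, i)\<close> to \<open>A t i\<close>.
\<close>

definition primitive_element :: "'a::field \<Rightarrow> bool" where
  "primitive_element c \<longleftrightarrow> c \<noteq> 0 \<and> range (\<lambda>m::nat. c ^ m) = UNIV - {0}"

definition array_code :: "nat \<Rightarrow> nat \<Rightarrow> nat \<Rightarrow> (nat \<Rightarrow> nat \<Rightarrow> 'a::field mat) \<Rightarrow> (nat \<Rightarrow> 'a vec) set" where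
  "array_code n k N A =
     {f \<in> {0..<n} \<rightarrow>\<^sub>E carrier_vec N.
        \<forall>t<n - k. finsum_vec TYPE('a) N (\<lambda>i. A t i *\<^sub>v f i) {0..<n} = 0\<^sub>v N}"

definition block_mat :: "nat \<Rightarrow> nat \<Rightarrow> (nat \<Rightarrow> nat \<Rightarrow> 'a mat) \<Rightarrow> 'a mat" where
  "block_mat r N B = mat (r * N) (r * N) (\<lambda>(x, y). B (x div N) (y div N) $$ (x mod N, y mod N))"

definition MDS_array_code :: "nat \<Rightarrow> nat \<Rightarrow> nat \<Rightarrow> (nat \<Rightarrow> nat \<Rightarrow> 'a::field mat) \<Rightarrow> bool" where
  "MDS_array_code n k N A \<longleftrightarrow>
     (\<forall>\<iota> :: nat \<Rightarrow> nat. strict_mono_on {0..<n - k} \<iota> \<and> \<iota> ` {0..<n - k} \<subseteq> {0..<n} \<longrightarrow>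
        invertible_mat (block_mat (n - k) N (\<lambda>t j. A t (\<iota> j))))"

definition mat_rank :: "'a::field mat \<Rightarrow> nat" where
  "mat_rank M = vec_space.rank (dim_row M) M"

definition full_rank :: "'a::field mat \<Rightarrow> bool" where
  "full_rank M \<longleftrightarrow> mat_rank M = min (dim_row M) (dim_col M)"

text \<open>Recovery is by an arbitrary function of the downloaded data, the same for all codewords.\<close>

definition recoverable ::
  "(nat \<Rightarrow> 'a::field vec) set \<Rightarrow> nat \<Rightarrow> nat set \<Rightarrow> (nat \<Rightarrow> 'a mat) \<Rightarrow> bool" where
  "recoverable C i H R \<longleftrightarrow>
     (\<exists>g :: (nat \<Rightarrow> 'a vec) \<Rightarrow> 'a vec. \<forall>f\<in>C. g (\<lambda>j\<in>H. R j *\<^sub>v f j) = f i)"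

text \<open>
  The compulsory helper nodes \<open>K\<close> and the repair matrices \<open>R\<close> depend on the failed node \<open>i\<close> only,
  not on the set \<open>H\<close> of helper nodes.
\<close>

definition repair_property ::
  "nat \<Rightarrow> nat \<Rightarrow> nat \<Rightarrow> nat \<Rightarrow> nat \<Rightarrow> real \<Rightarrow> (nat \<Rightarrow> 'a::field vec) set \<Rightarrow> bool" where
  "repair_property n k N d d\<^sub>c \<epsilon> C \<longleftrightarrow>
     (\<forall>i<n. \<exists>K R.
        K \<subseteq> {0..<n} - {i} \<and> card K = d\<^sub>c \<and>
        (\<forall>j\<in>{0..<n} - {i}. dim_col (R j) = N \<and> full_rank (R j)) \<and>
        (\<forall>H. H \<subseteq> {0..<n} - {i} \<and> card H = d \<and> K \<subseteq> H \<longrightarrow>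
           recoverable C i H R \<and>
           (\<Sum>j\<in>H. real (mat_rank (R j)))
             \<le> (1 + \<epsilon>) * (real d / (real d - real k + 1)) * real N))"

definition digit :: "nat \<Rightarrow> nat \<Rightarrow> nat \<Rightarrow> nat \<Rightarrow> nat" where
  "digit w m a j = a div w ^ (m - 1 - j) mod w"

text \<open>
  In \<open>i = z w m + y m + b\<close> with \<open>y < w\<close> and \<open>b < m\<close>, the three parts are
  \<open>z = i div (w * m)\<close>, \<open>y = i div m mod w\<close> and \<open>b = i mod m\<close>.
\<close>

definition xi :: "'a::field \<Rightarrow> nat \<Rightarrow> nat \<Rightarrow> nat \<Rightarrow> nat \<Rightarrow> 'a" where
  "xi c w m i u =
     (let z = i div (w * m); y = i div m mod w; b = i mod m
      in c ^ (z * w * m + b * w + (u + y) mod w))"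

lemma xi_eq:
  assumes "y < w" and "b < m"
  shows "xi c w m (z * w * m + y * m + b) u = c ^ (z * w * m + b * w + (u + y) mod w)"
proof -
  let ?i = "z * w * m + y * m + b"
  have i: "?i = b + (z * w + y) * m"
    by (simp add: algebra_simps)
  have ym: "?i div m = z * w + y" and b: "?i mod m = b"
    unfolding i using assms by simp_all
  have z: "?i div (w * m) = z"
    using assms by (simp add: ym div_mult2_eq mult.commute[of w m])
  show ?thesis
    using assms by (simp add: xi_def Let_def ym b z)
qed

definition std_row :: "nat \<Rightarrow> nat \<Rightarrow> 'a::field mat" where
  "std_row N a = mat_of_rows N [unit_vec N a]"

definition node_mat :: "'a::field \<Rightarrow> nat \<Rightarrow> nat \<Rightarrow> nat \<Rightarrow> 'a mat" where
  "node_mat c w m i =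
     (let N = w ^ m in
      \<Oplus>\<^bsub>module_mat TYPE('a) N N\<^esub>a\<in>{0..<N}.
        xi c w m i (digit w m a (i mod m)) \<cdot>\<^sub>m ((std_row N a)\<^sup>T * std_row N a))"

end

theory Submission
  imports Defs
begin

text \<open>
  All \<open>A\<^sub>i\<close> are diagonal, so for each coordinate \<open>a\<close> the parity checks form a Vandermonde system
  with nodes \<open>\<xi>'\<^bsub>i,a\<^esub>\<close>. These are distinct because the exponents of the primitive
  element are distinct and smaller than \<open>q - 1\<close>; this gives the MDS property.

  To repair node \<open>i\<close> with \<open>b = i mod m\<close>, the \<open>s - 1\<close> other nodes congruent to \<open>i\<close>
  modulo \<open>m\<close> are compulsory and send everything, while any other helper sends, for each choice of
  the remaining digits, the sum of its entries over the digit at position \<open>b\<close>. Summing the parity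
  checks over that digit leaves a Vandermonde system with \<open>w\<close> unknown entries of node \<open>i\<close> and one
  unknown sum for each of the \<open>n - 1 - d = r - w\<close> nodes that do not help, that is, \<open>r\<close> unknowns in
  \<open>r\<close> equations.
\<close>

section \<open>Vandermonde systems\<close>

text \<open>The equations, weighted by the coefficients of the polynomial \<open>p\<close> of degree
  \<open>card I - 1 < r\<close> with roots \<open>x j\<close> for \<open>j \<noteq> i\<close>, add
  up to \<open>poly p (x i) * v i = 0\<close>, and the first factor is nonzero.\<close>

lemma vandermonde_kernel:
  fixes x v :: "'i \<Rightarrow> 'a::field"
  assumes fin: "finite I" and card: "card I \<le> r" and inj: "inj_on x I"
    and eqs: "\<And>t. t < r \<Longrightarrow> (\<Sum>i\<in>I. x i ^ t * v i) = 0"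
    and i: "i \<in> I"
  shows "v i = 0"
proof -
  define p where "p = (\<Prod>j\<in>I - {i}. [:- x j, 1:])"
  have "degree p = card (I - {i})"
    unfolding p_def using fin by (subst degree_prod_eq_sum_degree) auto
  also have "\<dots> < card I"
    using fin i by (rule card_Diff1_less)
  finally have deg: "degree p < r"
    using card by simp
  have root: "poly p (x j) = 0 \<longleftrightarrow> j \<noteq> i" if "j \<in> I" for j
    unfolding p_def poly_prod using fin that i inj by (auto simp: inj_on_def prod_zero_iff)
  have "(\<Sum>j\<in>I. poly p (x j) * v j) = (\<Sum>j\<in>I. \<Sum>t\<le>degree p. coeff p t * (x j ^ t * v j))"
    by (simp add: poly_altdef sum_distrib_right mult.assoc)
  also have "\<dots> = (\<Sum>t\<le>degree p. coeff p t * (\<Sum>j\<in>I. x j ^ t * v j))"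
    by (subst sum.swap) (simp add: sum_distrib_left)
  also have "\<dots> = 0"
    using deg eqs by (intro sum.neutral) auto
  finally have "(\<Sum>j\<in>I. poly p (x j) * v j) = 0" .
  moreover have "(\<Sum>j\<in>I. poly p (x j) * v j) = poly p (x i) * v i"
    using fin i root by (subst sum.remove[of _ i]) (auto intro: sum.neutral)
  ultimately show ?thesis
    using root[OF i] by simp
qed

section \<open>Distinctness of the parameters \<open>xi\<close>\<close>

text \<open>A repetition among these exponents would give \<open>c ^ l = 1\<close> with
  \<open>0 < l < CARD('a) - 1\<close>, leaving at most \<open>l\<close> distinct powers, too few to
  fill the nonzero elements.\<close>

lemma primitive_element_inj_on:
  fixes c :: "'a::{field, finite}"
  assumes "primitive_element c"
  shows "inj_on (\<lambda>e. c ^ e) {..<CARD('a) - 1}"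
proof -
  have c0: "c \<noteq> 0" and ran: "range (\<lambda>e::nat. c ^ e) = UNIV - {0}"
    using assms by (auto simp: primitive_element_def)
  have "c ^ x \<noteq> c ^ y" if "x < y" and y: "y < CARD('a) - 1" for x y
  proof
    assume eq: "c ^ x = c ^ y"
    define l where "l = y - x"
    have l: "l > 0" "l < CARD('a) - 1"
      using that by (auto simp: l_def)
    have "c ^ x * c ^ l = c ^ y"
      using that by (simp add: l_def flip: power_add)
    then have cl: "c ^ l = 1"
      using c0 by (simp flip: eq)
    have "c ^ e = c ^ (e mod l)" for e
    proof -
      have "c ^ e = c ^ (l * (e div l) + e mod l)"
        by simp
      also have "\<dots> = (c ^ l) ^ (e div l) * c ^ (e mod l)"
        by (simp only: power_add power_mult)
      finally show ?thesis
        by (simp add: cl)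
    qed
    then have "c ^ e \<in> (\<lambda>e. c ^ e) ` {..<l}" for e
      using l by (intro image_eqI[of _ _ "e mod l"]) auto
    then have "range (\<lambda>e::nat. c ^ e) \<subseteq> (\<lambda>e. c ^ e) ` {..<l}"
      by blast
    then have "card (range (\<lambda>e::nat. c ^ e)) \<le> l"
      using surj_card_le[of "{..<l}"] by simp
    then show False
      using l by (simp add: ran)
  qed
  then show ?thesis
    by (intro linorder_inj_onI) auto
qed

lemma mult_add_less_eq_iff:
  fixes w :: nat
  assumes "t < w" "t' < w"
  shows "q * w + t = q' * w + t' \<longleftrightarrow> q = q' \<and> t = t'"
proof
  assume eq: "q * w + t = q' * w + t'"
  have "q = (q * w + t) div w"
    using assms by simp
  also have "\<dots> = q'"
    unfolding eq using assms by simp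
  finally show "q = q' \<and> t = t'"
    using eq by simp
qed simp

text \<open>The bound on the field size keeps all exponents below \<open>CARD('a) - 1\<close>, so
  equal powers have equal exponents, and these are compared digit by digit in mixed radix.\<close>

lemma xi_eq_iff:
  fixes c :: "'a::{field, finite}"
  assumes prim: "primitive_element c"
    and q: "CARD('a) > nat \<lceil>real s / real w\<rceil> * w * m"
    and w: "w > 0" and m: "m > 0"
    and i: "i < s * m" and j: "j < s * m"
  shows "xi c w m i u = xi c w m j v \<longleftrightarrow>
    i mod m = j mod m \<and> i div (w * m) = j div (w * m) \<and>
    (u + i div m mod w) mod w = (v + j div m mod w) mod w"
proof -
  define M where "M = nat \<lceil>real s / real w\<rceil>"
  \<comment> \<open>The exponent in nested form, with lowest digit in base \<open>w\<close> and the
    next in base \<open>m\<close>, so that uniqueness of division with remainder applies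
    twice.\<close>
  define E where "E = (\<lambda>i u. (i div (w * m) * m + i mod m) * w + (u + i div m mod w) mod w)"
  have bound: "E l u < CARD('a) - 1" if "l < s * m" for l u
  proof -
    have "l div m < s"
      using that m by (simp add: less_mult_imp_div_less)
    \<comment> \<open>With \<open>z = l div m div w\<close> this is
      \<open>z * w \<le> l div m < s\<close>, so \<open>z\<close> lies below \<open>s / w\<close>
      and hence below its ceiling.\<close>
    then have "l div m div w * w < s"
      by (meson div_times_less_eq_dividend le_less_trans)
    then have "real (l div m div w) * real w < real s"
      by (metis of_nat_less_iff of_nat_mult)
    then have "real (l div m div w) < real s / real w"
      using w by (simp add: pos_less_divide_eq)
    then have "l div m div w < M"
      unfolding M_def by linarith
    then have "l div (w * m) < M"
      by (simp add: mult.commute[of w m] div_mult2_eq)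
    then have "Suc (l div (w * m)) * m \<le> M * m"
      by (intro mult_le_mono1) simp
    moreover have "l mod m < m"
      using m by simp
    ultimately have "Suc (l div (w * m) * m + l mod m) * w \<le> M * m * w"
      by (intro mult_le_mono1) simp
    moreover have "(u + l div m mod w) mod w < w"
      using w by simp
    ultimately have "E l u < M * m * w"
      unfolding E_def by simp
    then show ?thesis
      using q unfolding M_def by (simp add: ac_simps)
  qed
  have xi: "xi c w m l u = c ^ E l u" for l u
    by (simp add: xi_def E_def Let_def algebra_simps)
  have "xi c w m i u = xi c w m j v \<longleftrightarrow> E i u = E j v"
    unfolding xi using primitive_element_inj_on[OF prim] bound[OF i] bound[OF j]
    by (auto simp: inj_on_def)
  also have "\<dots> \<longleftrightarrow> i mod m = j mod m \<and> i div (w * m) = j div (w * m) \<and>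
    (u + i div m mod w) mod w = (v + j div m mod w) mod w"
    unfolding E_def using w m by (auto simp: mult_add_less_eq_iff)
  finally show ?thesis .
qed

lemma add_mod_left_cancel:
  fixes w :: nat
  assumes "(u + x) mod w = (u + y) mod w" and "x < w" and "y < w"
  shows "x = y"
proof -
  have "x mod w = y mod w"
    using assms(1) unfolding nat_mod_eq_iff by (simp add: add.assoc)
  then show ?thesis
    using assms by simp
qed

text \<open>Within one node the digit only undergoes a cyclic shift modulo \<open>w\<close>. In the
  repair this separates the \<open>w\<close> unknown entries of the failed node.\<close>

lemma xi_inj_on_digit:
  fixes c :: "'a::{field, finite}"
  assumes "primitive_element c" and "CARD('a) > nat \<lceil>real s / real w\<rceil> * w * m"
    and "w > 0" and "m > 0" and "i < s * m"
  shows "inj_on (xi c w m i) {..<w}"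
proof (rule inj_onI)
  fix u v assume uv: "u \<in> {..<w}" "v \<in> {..<w}" and "xi c w m i u = xi c w m i v"
  then have "(i div m mod w + u) mod w = (i div m mod w + v) mod w"
    using assms xi_eq_iff[of c s w m i i u v] by (simp only: add.commute)
  then show "u = v"
    by (rule add_mod_left_cancel) (use uv in auto)
qed

text \<open>Nodes with the same residue modulo \<open>m\<close> read the same digit, so equal
  shifted digits force equal shifts; with the common quotient and residue this fixes the node. In
  the application, \<open>g\<close> lists the digits of one coordinate.\<close>

lemma xi_inj_on_nodes:
  fixes c :: "'a::{field, finite}"
  assumes "primitive_element c" and "CARD('a) > nat \<lceil>real s / real w\<rceil> * w * m"
    and "w > 0" and "m > 0"
  shows "inj_on (\<lambda>i. xi c w m i (g (i mod m))) {..<s * m}"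
proof (rule inj_onI)
  fix i j assume "i \<in> {..<s * m}" "j \<in> {..<s * m}"
    "xi c w m i (g (i mod m)) = xi c w m j (g (j mod m))"
  then have "i mod m = j mod m \<and> i div (w * m) = j div (w * m) \<and>
    (g (i mod m) + i div m mod w) mod w = (g (j mod m) + j div m mod w) mod w"
    by (intro iffD1[OF xi_eq_iff[OF assms]]) simp_all
  then have eq: "i mod m = j mod m" "i div (w * m) = j div (w * m)"
    "(g (i mod m) + i div m mod w) mod w = (g (j mod m) + j div m mod w) mod w"
    by blast+
  have "i div m mod w = j div m mod w"
    by (rule add_mod_left_cancel[of "g (j mod m)"]) (use eq \<open>w > 0\<close> in auto)
  moreover have "i div m div w = j div m div w"
    using eq(2) by (simp add: div_mult2_eq mult.commute[of w m])
  ultimately have "i div m = j div m"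
    by (metis div_mult_mod_eq)
  with eq(1) show "i = j"
    by (metis div_mult_mod_eq)
qed

section \<open>Node matrices and parity checks in diagonal form\<close>

lemma index_finsum_mat:
  assumes "finite F" and "i < nr" and "j < nc"
    and "f \<in> F \<rightarrow> carrier_mat nr nc"
  shows "(finsum (module_mat TYPE('a::comm_ring_1) nr nc) f F) $$ (i, j) = (\<Sum>x\<in>F. f x $$ (i, j))"
    and "finsum (module_mat TYPE('a::comm_ring_1) nr nc) f F \<in> carrier_mat nr nc"
proof -
  interpret abelian_group "module_mat TYPE('a) nr nc"
    by (rule abelian_group_mat)
  show "finsum (module_mat TYPE('a) nr nc) f F \<in> carrier_mat nr nc"
    using finsum_closed[of f F] assms by (simp add: module_mat_simps)
  show "(finsum (module_mat TYPE('a) nr nc) f F) $$ (i, j) = (\<Sum>x\<in>F. f x $$ (i, j))"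
    using assms(1,4)
  proof (induction F)
    case empty
    then show ?case
      using assms by (simp add: module_mat_simps)
  next
    case (insert x F)
    have "finsum (module_mat TYPE('a) nr nc) f F \<in> carrier_mat nr nc"
      using finsum_closed[of f F] insert by (simp add: module_mat_simps)
    with insert show ?case
      using assms(2,3) by (subst finsum_insert) (auto simp: module_mat_simps)
  qed
qed

text \<open>Each summand is a multiple of the matrix unit at \<open>(a, a)\<close>, so the entry at
  \<open>(x, y)\<close> receives only the term \<open>a = x\<close>, and only if
  \<open>x = y\<close>.\<close>

lemma node_mat_eq_diag:
  assumes "w > 0"
  shows "node_mat c w m i = mat_diag (w ^ m) (\<lambda>a. xi c w m i (digit w m a (i mod m)))"
proof -
  define N where "N = w ^ m"
  define f where "f = (\<lambda>a. xi c w m i (digit w m a (i mod m)) \<cdot>\<^sub>m ((std_row N a)\<^sup>T * std_row N a))"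
  have row: "std_row N a \<in> carrier_mat 1 N" for a :: nat
    using mat_of_rows_carrier(1)[of N "[unit_vec N a]"] by (simp add: std_row_def)
  have f: "f a \<in> carrier_mat N N" for a
    unfolding f_def using row[of a]
    by (intro smult_carrier_mat mult_carrier_mat[of _ N 1]) simp_all
  have entry: "f a $$ (x, y) =
      (if x = a \<and> y = a then xi c w m i (digit w m a (i mod m)) else 0)"
    if "x < N" "y < N" "a < N" for a x y
  proof -
    have "dim_row (std_row N a :: 'a mat) = 1" "dim_col (std_row N a :: 'a mat) = N"
      using row[of a] by auto
    moreover have "std_row N a $$ (0, z) = (if z = a then 1 else 0 :: 'a)" if "z < N" for z
      using that \<open>a < N\<close> by (simp add: std_row_def mat_of_rows_def)
    ultimately show ?thesis
      using that by (simp add: f_def scalar_prod_def)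
  qed
  have "node_mat c w m i = finsum (module_mat TYPE('a) N N) f {0..<N}"
    by (simp add: node_mat_def Let_def N_def f_def)
  also have "\<dots> = mat_diag N (\<lambda>a. xi c w m i (digit w m a (i mod m)))"
    (is "?S = ?D")
  proof (rule eq_matI)
    have N: "0 < N"
      using assms by (simp add: N_def)
    have S: "?S \<in> carrier_mat N N"
      using index_finsum_mat(2)[OF _ N N] f by blast
    have D: "?D \<in> carrier_mat N N"
      by (rule mat_diag_dim)
    show "dim_row ?S = dim_row ?D" "dim_col ?S = dim_col ?D"
      using carrier_matD[OF S] carrier_matD[OF D] by simp_all
    fix x y assume "x < dim_row ?D" "y < dim_col ?D"
    then have xy: "x < N" "y < N"
      using carrier_matD[OF D] by simp_all
    have "?S $$ (x, y) = (\<Sum>a\<in>{0..<N}. f a $$ (x, y))"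
      using xy f by (intro index_finsum_mat(1)) auto
    also have "\<dots> = (\<Sum>a\<in>{0..<N}. if a = x then
        (if x = y then xi c w m i (digit w m x (i mod m)) else 0) else 0)"
      using xy by (intro sum.cong) (auto simp: entry)
    also have "\<dots> = ?D $$ (x, y)"
      using xy by (simp add: mat_diag_def)
    finally show "?S $$ (x, y) = ?D $$ (x, y)" .
  qed
  finally show ?thesis
    by (simp add: N_def)
qed

lemma mat_diag_pow:
  "mat_diag n (f :: nat \<Rightarrow> 'a::comm_ring_1) ^\<^sub>m t = mat_diag n (\<lambda>i. f i ^ t)"
proof (induction t)
  case (Suc t)
  then show ?case
    by (simp add: mat_diag_diag mult.commute)
qed (simp add: mat_diag_def one_mat_def)

lemma mat_diag_mult_vec_index:
  assumes "v \<in> carrier_vec n" and "a < n"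
  shows "(mat_diag n (f :: nat \<Rightarrow> 'a::semiring_1) *\<^sub>v v) $ a = f a * v $ a"
proof -
  have "(mat_diag n f *\<^sub>v v) $ a = (\<Sum>b<n. (if a = b then f b else 0) * v $ b)"
    using assms by (simp add: mat_diag_def scalar_prod_def atLeast0LessThan)
  also have "\<dots> = (\<Sum>b<n. if b = a then f a * v $ a else 0)"
    by (rule sum.cong) auto
  finally show ?thesis
    using assms by simp
qed

text \<open>Diagonal blocks act coordinatewise, so each coordinate \<open>a\<close> carries its own
  scalar system of parity checks.\<close>

lemma array_code_diag_parity:
  assumes "f \<in> array_code n k N (\<lambda>t i. mat_diag N (\<lambda>a. x i a ^ t))"
    and "t < n - k" and "a < N"
  shows "(\<Sum>i<n. x i a ^ t * f i $ a) = 0"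
proof -
  have f: "f i \<in> carrier_vec N" if "i < n" for i
    using assms(1) that by (auto simp: array_code_def)
  have "0 = finsum_vec TYPE('a) N (\<lambda>i. mat_diag N (\<lambda>a. x i a ^ t) *\<^sub>v f i) {0..<n} $ a"
    using assms by (simp add: array_code_def)
  also have "\<dots> = (\<Sum>i\<in>{0..<n}. (mat_diag N (\<lambda>a. x i a ^ t) *\<^sub>v f i) $ a)"
    using assms(3) f by (intro index_finsum_vec) (auto intro!: mult_mat_vec_carrier mat_diag_dim)
  also have "\<dots> = (\<Sum>i\<in>{0..<n}. x i a ^ t * f i $ a)"
    using assms(3) f by (intro sum.cong) (auto simp: mat_diag_mult_vec_index)
  finally show ?thesis
    by (simp add: atLeast0LessThan)
qed

section \<open>The MDS property for diagonal blocks\<close>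

lemma sum_lessThan_mult:
  fixes f :: "nat \<Rightarrow> 'b::comm_monoid_add"
  shows "(\<Sum>y<r * N. f y) = (\<Sum>j<r. \<Sum>b<N. f (j * N + b))"
proof -
  have "sum f {j * N..<j * N + N} = (\<Sum>b<N. f (j * N + b))" for j
    using sum.atLeastLessThan_shift_0[of f "j * N" "j * N + N"]
    by (simp add: atLeast0LessThan)
  then show ?thesis
    by (simp flip: sum.nat_group)
qed

text \<open>For a kernel vector \<open>v\<close> of the block matrix, the entries
  \<open>v $ (j * N + a)\<close> with fixed \<open>a\<close> solve an \<open>r\<close> by
  \<open>r\<close> Vandermonde system with distinct nodes, so \<open>v\<close> vanishes.\<close>

lemma MDS_array_code_diag:
  fixes x :: "nat \<Rightarrow> nat \<Rightarrow> 'a::field"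
  assumes inj: "\<And>a. a < N \<Longrightarrow> inj_on (\<lambda>i. x i a) {..<n}"
  shows "MDS_array_code n k N (\<lambda>t i. mat_diag N (\<lambda>a. x i a ^ t))"
  unfolding MDS_array_code_def
proof (intro allI impI, elim conjE)
  fix \<iota> :: "nat \<Rightarrow> nat"
  define r where "r = n - k"
  assume mono: "strict_mono_on {0..<n - k} \<iota>" and ran: "\<iota> ` {0..<n - k} \<subseteq> {0..<n}"
  define M where "M = block_mat r N (\<lambda>t j. mat_diag N (\<lambda>a. x (\<iota> j) a ^ t))"
  have M: "M \<in> carrier_mat (r * N) (r * N)"
    by (simp add: M_def block_mat_def)
  have "det M \<noteq> 0"
  proof
    assume "det M = 0"
    then obtain v where v: "v \<in> carrier_vec (r * N)" "v \<noteq> 0\<^sub>v (r * N)" "M *\<^sub>v v = 0\<^sub>v (r * N)"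
      using det_0_iff_vec_prod_zero_field[OF M] by blast
    have eqs: "(\<Sum>j<r. x (\<iota> j) a ^ t * v $ (j * N + a)) = 0" if t: "t < r" and a: "a < N" for t a
    proof -
      have lt: "l * N + b < r * N" if "l < r" "b < N" for l b
      proof -
        have "Suc l * N \<le> r * N"
          using that by (intro mult_le_mono1) simp
        then show ?thesis
          using that by simp
      qed
      have "0 = (M *\<^sub>v v) $ (t * N + a)"
        using v(3) lt[OF t a] by simp
      also have "\<dots> = (\<Sum>y<r * N. M $$ (t * N + a, y) * v $ y)"
        using M v(1) lt[OF t a] by (simp add: scalar_prod_def atLeast0LessThan)
      also have "\<dots> = (\<Sum>j<r. \<Sum>b<N. M $$ (t * N + a, j * N + b) * v $ (j * N + b))"
        by (rule sum_lessThan_mult)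
      also have "\<dots> = (\<Sum>j<r. \<Sum>b<N. if b = a then x (\<iota> j) a ^ t * v $ (j * N + a) else 0)"
        using t a lt by (intro sum.cong refl) (auto simp: M_def block_mat_def mat_diag_def)
      also have "\<dots> = (\<Sum>j<r. x (\<iota> j) a ^ t * v $ (j * N + a))"
        using a by simp
      finally show ?thesis
        by simp
    qed
    have zero: "v $ (j * N + a) = 0" if "j < r" and a: "a < N" for j a
    proof (rule vandermonde_kernel[where I = "{..<r}" and i = j and v = "\<lambda>j. v $ (j * N + a)"])
      have "inj_on \<iota> {..<r}"
        using mono strict_mono_on_imp_inj_on by (auto simp: r_def atLeast0LessThan)
      moreover have "\<iota> ` {..<r} \<subseteq> {..<n}"
        using ran by (simp add: r_def atLeast0LessThan)
      ultimately have "inj_on ((\<lambda>i. x i a) \<circ> \<iota>) {..<r}"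
        using inj_on_subset[OF inj[OF a]] by (intro comp_inj_on)
      then show "inj_on (\<lambda>j. x (\<iota> j) a) {..<r}"
        by (simp add: comp_def)
    qed (use eqs a that in auto)
    have "v = 0\<^sub>v (r * N)"
    proof (rule eq_vecI)
      fix y assume "y < dim_vec (0\<^sub>v (r * N) :: 'a vec)"
      then have y: "y < r * N"
        by simp
      then have "N > 0"
        by (cases N) auto
      then have "v $ (y div N * N + y mod N) = 0"
        using y by (intro zero) (auto simp: less_mult_imp_div_less)
      then show "v $ y = 0\<^sub>v (r * N) $ y"
        using y by simp
    qed (use v in auto)
    then show False
      using v by simp
  qed
  then have "M \<in> Units (ring_mat TYPE('a) (r * N) ())"
    by (rule det_non_zero_imp_unit[OF M])
  then show "invertible_mat (block_mat (n - k) N (\<lambda>t j. mat_diag N (\<lambda>a. x (\<iota> j) a ^ t)))"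
    using M unfolding M_def r_def[symmetric]
    by (auto simp: Units_def ring_mat_def invertible_mat_def inverts_mat_def square_mat.simps)
qed

section \<open>Digits and the repair matrices that sum over a digit\<close>

text \<open>The column space is then the full space, of dimension \<open>dim_row M\<close>. Both
  kinds of repair matrix get their rank this way.\<close>

lemma mat_rank_surj:
  fixes M :: "'a::field mat"
  assumes "\<And>y. y \<in> carrier_vec (dim_row M) \<Longrightarrow> \<exists>x\<in>carrier_vec (dim_col M). M *\<^sub>v x = y"
  shows "mat_rank M = dim_row M"
proof -
  interpret vec_space "TYPE('a)" "dim_row M" .
  have "col_space M = carrier_vec (dim_row M)"
    using assms by (subst col_space_eq[of M "dim_col M"]) auto
  then have "span_vs (set (cols M)) = V"
    by (simp add: col_space_def)
  then show ?thesis
    by (simp add: mat_rank_def rank_def dim_is_n)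
qed

text \<open>
  \<open>put_digit w p u x\<close> inserts the digit \<open>u\<close> into the \<open>w\<close>-ary expansion of \<open>x\<close> at the
  place of value \<open>p\<close>, and \<open>drop_digit w p a\<close> removes that digit.
\<close>

definition put_digit :: "nat \<Rightarrow> nat \<Rightarrow> nat \<Rightarrow> nat \<Rightarrow> nat" where
  "put_digit w p u x = (x div p * w + u) * p + x mod p"

definition drop_digit :: "nat \<Rightarrow> nat \<Rightarrow> nat \<Rightarrow> nat" where
  "drop_digit w p a = a div p div w * p + a mod p"

lemma drop_put_digit: "p > 0 \<Longrightarrow> u < w \<Longrightarrow> drop_digit w p (put_digit w p u x) = x"
  by (simp add: drop_digit_def put_digit_def)

lemma put_drop_digit: "p > 0 \<Longrightarrow> put_digit w p (a div p mod w) (drop_digit w p a) = a"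
  by (simp add: drop_digit_def put_digit_def)

lemma put_digit_div_mod: "p > 0 \<Longrightarrow> u < w \<Longrightarrow> put_digit w p u x div p mod w = u"
  by (simp add: put_digit_def)

lemma put_digit_less:
  assumes "p > 0" and "u < w" and "x < q * p"
  shows "put_digit w p u x < q * w * p"
proof -
  have "x div p < q"
    using assms by (simp add: less_mult_imp_div_less)
  then have "Suc (x div p) * w \<le> q * w"
    by (intro mult_le_mono1) simp
  then have "Suc (x div p * w + u) * p \<le> q * w * p"
    using assms by (intro mult_le_mono1) simp
  moreover have "x mod p < p"
    using assms by simp
  ultimately show ?thesis
    by (simp add: put_digit_def)
qed

lemma drop_digit_less:
  assumes "p > 0" and "a < q * w * p"
  shows "drop_digit w p a < q * p"
proof -
  have "a div p div w < q"
    using assms by (simp add: less_mult_imp_div_less)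
  then have "Suc (a div p div w) * p \<le> q * p"
    by (intro mult_le_mono1) simp
  moreover have "a mod p < p"
    using assms by simp
  ultimately show ?thesis
    by (simp add: drop_digit_def)
qed

text \<open>Let \<open>p = w ^ (m - 1 - b)\<close>. For \<open>j < b\<close> the place value of
  digit \<open>j\<close> is a multiple of \<open>p * w\<close>, and dividing by \<open>p * w\<close>
  discards the inserted digit. For \<open>j > b\<close> that place value times \<open>w\<close>
  divides \<open>p\<close>, so the part from \<open>p\<close> upwards contributes a multiple of
  \<open>w\<close>.\<close>

lemma digit_put_digit_other:
  assumes "b < m" and "j < m" and "j \<noteq> b" and "w > 0" and "u < w"
  shows "digit w m (put_digit w (w ^ (m - 1 - b)) u x) j =
    digit w m (put_digit w (w ^ (m - 1 - b)) 0 x) j"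
proof -
  define p where "p = w ^ (m - 1 - b)"
  have p: "p > 0"
    using assms by (simp add: p_def)
  have "put_digit w p u x div w ^ (m - 1 - j) mod w = put_digit w p 0 x div w ^ (m - 1 - j) mod w"
  proof (cases "j < b")
    case True
    then have split: "m - 1 - j = (m - 1 - b) + Suc (b - j - 1)"
      using assms by linarith
    have e: "w ^ (m - 1 - j) = p * w * w ^ (b - j - 1)"
      unfolding split p_def power_add by simp
    have "put_digit w p u x div (p * w) = put_digit w p 0 x div (p * w)"
      using p assms by (simp add: put_digit_def div_mult2_eq)
    then show ?thesis
      unfolding e div_mult2_eq[of _ "p * w"] by (simp only:)
  next
    case False
    define e where "e = m - 1 - j"
    have split: "m - 1 - b = e + Suc (j - b - 1)"
      using False assms by (simp add: e_def)
    have e: "p = w ^ e * (w * w ^ (j - b - 1))"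
      unfolding split p_def power_add by simp
    have "(h * p + l) div w ^ e mod w = l div w ^ e mod w" for h l
    proof -
      have "h * p + l = l + (h * w ^ (j - b - 1) * w) * w ^ e"
        by (simp add: e algebra_simps)
      then have "(h * p + l) div w ^ e = h * w ^ (j - b - 1) * w + l div w ^ e"
        using assms by (simp only: div_mult_self1) simp
      then show ?thesis
        by simp
    qed
    then show ?thesis
      unfolding put_digit_def e_def[symmetric] by (simp only:)
  qed
  then show ?thesis
    by (simp add: digit_def p_def)
qed

text \<open>In place of all \<open>q * w * p\<close> entries of a node this transmits
  \<open>q * p\<close> sums over the digit of place value \<open>p\<close>; \<open>q\<close> counts
  the values of the part above that digit.\<close>

definition digit_sum_mat :: "nat \<Rightarrow> nat \<Rightarrow> nat \<Rightarrow> 'a::field mat" where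
  "digit_sum_mat w p q = mat (q * p) (q * w * p) (\<lambda>(x, a). if drop_digit w p a = x then 1 else 0)"

lemma digit_sum_mat_mult_vec:
  fixes v :: "'a::field vec"
  assumes p: "p > 0" and v: "v \<in> carrier_vec (q * w * p)" and x: "x < q * p"
  shows "(digit_sum_mat w p q *\<^sub>v v) $ x = (\<Sum>u<w. v $ put_digit w p u x)"
proof -
  have "(digit_sum_mat w p q *\<^sub>v v) $ x =
      (\<Sum>a<q * w * p. (if drop_digit w p a = x then 1 else 0) * v $ a)"
    using v x by (simp add: digit_sum_mat_def scalar_prod_def atLeast0LessThan)
  also have "\<dots> = (\<Sum>a\<in>{a. a < q * w * p \<and> drop_digit w p a = x}. v $ a)"
    by (intro sum.mono_neutral_cong_right) auto
  also have "\<dots> = (\<Sum>u<w. v $ put_digit w p u x)"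
  proof (rule sum.reindex_bij_witness[where i = "\<lambda>u. put_digit w p u x" and j = "\<lambda>a. a div p mod w"])
    fix a assume a: "a \<in> {a. a < q * w * p \<and> drop_digit w p a = x}"
    then show "put_digit w p (a div p mod w) x = a"
      using put_drop_digit[OF p, of w a] by simp
    then show "v $ put_digit w p (a div p mod w) x = v $ a"
      by simp
    have "w > 0"
      using a by (cases w) auto
    then show "a div p mod w \<in> {..<w}"
      by simp
  qed (use p x in \<open>auto simp: put_digit_div_mod drop_put_digit put_digit_less\<close>)
  finally show ?thesis .
qed

text \<open>A preimage of \<open>y\<close> puts its entries at the coordinates with digit
  \<open>0\<close> and zero elsewhere, so every sum over the digit reduces to one term.\<close>

lemma mat_rank_digit_sum_mat:
  assumes p: "p > 0" and w: "w > 0"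
  shows "mat_rank (digit_sum_mat w p q :: 'a::field mat) = q * p"
proof -
  have "\<exists>v\<in>carrier_vec (q * w * p). digit_sum_mat w p q *\<^sub>v v = y"
    if y: "y \<in> carrier_vec (q * p)" for y :: "'a vec"
  proof
    define v where "v = vec (q * w * p) (\<lambda>a. if a div p mod w = 0 then y $ drop_digit w p a else 0)"
    show v: "v \<in> carrier_vec (q * w * p)"
      by (simp add: v_def)
    show "digit_sum_mat w p q *\<^sub>v v = y"
    proof (rule eq_vecI)
      fix x assume "x < dim_vec y"
      then have x: "x < q * p"
        using y by simp
      have "(digit_sum_mat w p q *\<^sub>v v) $ x = (\<Sum>u<w. v $ put_digit w p u x)"
        using p v x by (rule digit_sum_mat_mult_vec)
      also have "\<dots> = (\<Sum>u<w. if u = 0 then y $ x else 0)"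
        using p x by (intro sum.cong)
          (auto simp: v_def put_digit_less put_digit_div_mod drop_put_digit)
      finally show "(digit_sum_mat w p q *\<^sub>v v) $ x = y $ x"
        using w by simp
    qed (use y in \<open>simp add: digit_sum_mat_def\<close>)
  qed
  then have "mat_rank (digit_sum_mat w p q :: 'a mat) = dim_row (digit_sum_mat w p q :: 'a mat)"
    by (intro mat_rank_surj) (simp add: digit_sum_mat_def)
  then show ?thesis
    by (simp add: digit_sum_mat_def)
qed

section \<open>Repair of a failed node\<close>

text \<open>The decoder may be an arbitrary function: it picks any codeword with the received data
  and returns its entry at \<open>i\<close>.\<close>

lemma recoverableI:
  assumes "\<And>f f'. f \<in> C \<Longrightarrow> f' \<in> C \<Longrightarrow> (\<And>j. j \<in> H \<Longrightarrow> R j *\<^sub>v f j = R j *\<^sub>v f' j) \<Longrightarrow> f i = f' i"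
  shows "recoverable C i H R"
  unfolding recoverable_def
proof (intro exI ballI)
  fix f assume f: "f \<in> C"
  define D where "D = (\<lambda>f. \<lambda>j\<in>H. R j *\<^sub>v f j)"
  define f' where "f' = (SOME f'. f' \<in> C \<and> D f' = D f)"
  have f': "f' \<in> C \<and> D f' = D f"
    unfolding f'_def by (rule someI[of _ f]) (simp add: f)
  have same: "R j *\<^sub>v f' j = R j *\<^sub>v f j" if "j \<in> H" for j
  proof -
    have "D f' j = D f j"
      using f' by simp
    then show ?thesis
      using that by (simp add: D_def)
  qed
  have "f' i = f i"
    by (rule assms) (use f f' same in auto)
  then show "(\<lambda>D'. (SOME f'. f' \<in> C \<and> D f' = D') i) (\<lambda>j\<in>H. R j *\<^sub>v f j) = f i"
    by (simp add: f'_def D_def)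
qed

theorem theorem7:
  fixes s w r m n k N d d\<^sub>c :: nat
    and c :: "'a::{field, finite}"
    and A :: "nat \<Rightarrow> nat \<Rightarrow> 'a mat"
  assumes "s \<ge> 2" and "2 \<le> w" and "w < r" and "r < m"
    and "N = w ^ m" and "n = s * m" and "k = n - r"
    and "CARD('a) > nat \<lceil>real s / real w\<rceil> * w * m"
    and "primitive_element c"
    and "d = k + w - 1" and "d\<^sub>c = s - 1"
    and "A = (\<lambda>t i. node_mat c w m i ^\<^sub>m t)"
  shows "MDS_array_code n k N A \<and>
         repair_property n k N d d\<^sub>c (real d\<^sub>c * (real d - real k) / real d) (array_code n k N A)"
proof
  have w: "w > 0" and m: "m > 0"
    using assms by simp_all
  \<comment> \<open>Together with \<open>r < m\<close> this keeps the truncated subtraction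
    \<open>k = n - r\<close> exact and \<open>k\<close> positive.\<close>
  have "2 * m \<le> n"
    unfolding \<open>n = s * m\<close> using assms by (intro mult_le_mono1) simp
  then have k: "k > 0" and r: "n - k = r" and d: "d + Suc r = n + w" and "d > 0"
    using assms by linarith+
  note params = \<open>primitive_element c\<close> \<open>CARD('a) > nat \<lceil>real s / real w\<rceil> * w * m\<close> w m
  define x where "x = (\<lambda>i a. xi c w m i (digit w m a (i mod m)))"
  have A: "A = (\<lambda>t i. mat_diag N (\<lambda>a. x i a ^ t))"
    using w assms(5,12) by (simp add: node_mat_eq_diag mat_diag_pow x_def)
  have inj: "inj_on (\<lambda>i. x i a) {..<n}" for a
    unfolding x_def \<open>n = s * m\<close> by (rule xi_inj_on_nodes[OF params])
  show "MDS_array_code n k N A"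
    unfolding A by (rule MDS_array_code_diag) (rule inj)
  show "repair_property n k N d d\<^sub>c (real d\<^sub>c * (real d - real k) / real d) (array_code n k N A)"
    unfolding repair_property_def
  proof (intro allI impI)
    fix i assume i: "i < n"
    define b p q where "b = i mod m" and "p = w ^ (m - 1 - b)" and "q = w ^ b"
    have b: "b < m"
      using m by (simp add: b_def)
    have p: "p > 0"
      using w by (simp add: p_def)
    have "N = w ^ (b + 1 + (m - 1 - b))"
      using b \<open>N = w ^ m\<close> by simp
    then have N: "N = q * w * p"
      unfolding p_def q_def power_add by simp
    \<comment> \<open>These nodes read the same digit as node \<open>i\<close>, so their parity
      coefficients vary with it and cannot be pulled out of a sum over that digit.\<close>
    define K where "K = {j. j < n \<and> j mod m = b} - {i}"
    define R :: "nat \<Rightarrow> 'a mat" where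
      "R = (\<lambda>j. if j \<in> K then 1\<^sub>m N else digit_sum_mat w p q)"
    have "{j. j < n \<and> j mod m = b} = (\<lambda>l. l * m + b) ` {..<s}"
    proof (intro equalityI subsetI)
      fix j assume "j \<in> {j. j < n \<and> j mod m = b}"
      then show "j \<in> (\<lambda>l. l * m + b) ` {..<s}"
        using m \<open>n = s * m\<close>
        by (intro image_eqI[of _ _ "j div m"]) (auto simp: less_mult_imp_div_less)
    next
      fix j assume "j \<in> (\<lambda>l. l * m + b) ` {..<s}"
      then obtain l where l: "l < s" "j = l * m + b"
        by auto
      then have "Suc l * m \<le> n"
        unfolding \<open>n = s * m\<close> by (intro mult_le_mono1) simp
      then show "j \<in> {j. j < n \<and> j mod m = b}"
        using l b by simp
    qed
    moreover have "inj_on (\<lambda>l. l * m + b) {..<s}"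
      using m by (auto simp: inj_on_def)
    ultimately have "card {j. j < n \<and> j mod m = b} = s"
      by (simp add: card_image)
    then have cardK: "card K = d\<^sub>c"
      using i assms(11) by (simp add: K_def b_def)
    have K: "K \<subseteq> {0..<n} - {i}" and finK: "finite K"
      by (auto simp: K_def)
    have rank_1: "mat_rank (1\<^sub>m N :: 'a mat) = N"
      by (subst mat_rank_surj) (auto intro: bexI[of _ "_ :: 'a vec"])
    have rank_R: "mat_rank (R j) = (if j \<in> K then N else q * p)" for j
      using p w by (simp add: R_def rank_1 mat_rank_digit_sum_mat)
    \<comment> \<open>A digit-sum matrix has \<open>q * p\<close> rows and \<open>N\<close> columns,
      so this makes its rank the minimum in \<open>full_rank\<close>.\<close>
    have "q * p \<le> N"
      using w by (simp add: N)
    then have full: "dim_col (R j) = N \<and> full_rank (R j)" for j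
      unfolding full_rank_def rank_R by (simp add: R_def digit_sum_mat_def flip: N)
    have bandwidth: "(\<Sum>j\<in>H. real (mat_rank (R j)))
        \<le> (1 + real d\<^sub>c * (real d - real k) / real d) * (real d / (real d - real k + 1)) * real N"
      if H: "H \<subseteq> {0..<n} - {i}" "card H = d" "K \<subseteq> H" for H
    proof -
      have finH: "finite H"
        using H(1) finite_subset by blast
      have le: "d\<^sub>c \<le> d"
        using card_mono[OF finH H(3)] by (simp add: cardK H(2))
      \<comment> \<open>A helper costs \<open>N\<close> inside \<open>K\<close> and
        \<open>q * p = N / w\<close> outside. As \<open>w = d - k + 1\<close>, the total equals the
        bound exactly.\<close>
      have "(\<Sum>j\<in>H. real (mat_rank (R j))) =
          (\<Sum>j\<in>H - K. real (mat_rank (R j))) + (\<Sum>j\<in>K. real (mat_rank (R j)))"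
        using H(3) finH by (rule sum.subset_diff)
      also have "\<dots> = real (d - d\<^sub>c) * real (q * p) + real d\<^sub>c * real N"
        using card_Diff_subset[OF finK H(3)] by (simp add: rank_R cardK H(2))
      also have "\<dots> = (real d + real d\<^sub>c * (real w - 1)) * real (q * p)"
        using le by (simp add: N of_nat_diff algebra_simps)
      also have "\<dots> = (real d + real d\<^sub>c * (real w - 1)) * real N / real w"
        using w by (simp add: N)
      also have "\<dots> = (1 + real d\<^sub>c * (real w - 1) / real d) * (real d / real w) * real N"
        using \<open>d > 0\<close> w by (simp add: field_simps)
      also have "real w = real d - real k + 1"
        using assms(10) w by (simp add: of_nat_diff)
      finally show ?thesis
        by simp
    qed
    have recover: "recoverable (array_code n k N A) i H R"
      if H: "H \<subseteq> {0..<n} - {i}" "card H = d" "K \<subseteq> H" for H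
    proof (rule recoverableI)
      fix f f' assume f: "f \<in> array_code n k N A" and f': "f' \<in> array_code n k N A"
        and eq: "\<And>j. j \<in> H \<Longrightarrow> R j *\<^sub>v f j = R j *\<^sub>v f' j"
      have car: "f j \<in> carrier_vec N" "f' j \<in> carrier_vec N" if "j < n" for j
        using f f' that by (auto simp: array_code_def)
      \<comment> \<open>By linearity the difference of two codewords with the same data satisfies
        the parity checks and has zero data; its part at \<open>i\<close> has to vanish.\<close>
      define \<delta> where "\<delta> = (\<lambda>j a. f j $ a - f' j $ a)"
      have parity: "(\<Sum>j<n. x j a ^ t * \<delta> j a) = 0" if "t < r" "a < N" for t a
        using array_code_diag_parity[of f n k N x t a] array_code_diag_parity[of f' n k N x t a]
          f f' that r
        by (simp add: A \<delta>_def right_diff_distrib sum_subtractf)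
      have dK: "\<delta> j a = 0" if "j \<in> K" for j a
      proof -
        have "j < n"
          using that by (simp add: K_def)
        then show ?thesis
          using eq[of j] car[of j] that H(3) by (auto simp: R_def \<delta>_def)
      qed
      have dH: "(\<Sum>u<w. \<delta> j (put_digit w p u y)) = 0"
        if j: "j \<in> H" "j \<notin> K" and y: "y < q * p" for j y
      proof -
        have "j < n"
          using j H by auto
        then have "f j \<in> carrier_vec (q * w * p)" "f' j \<in> carrier_vec (q * w * p)"
          using car by (auto simp flip: N)
        moreover have "(digit_sum_mat w p q *\<^sub>v f j) $ y = (digit_sum_mat w p q *\<^sub>v f' j) $ y"
          using eq[OF j(1)] j(2) by (simp add: R_def)
        ultimately show ?thesis
          using p y by (simp add: digit_sum_mat_mult_vec \<delta>_def sum_subtractf)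
      qed
      have \<delta>_zero: "\<delta> i (put_digit w p u\<^sub>0 y) = 0" if u\<^sub>0: "u\<^sub>0 < w" and y: "y < q * p" for u\<^sub>0 y
      proof -
        \<comment> \<open>The unknowns are indexed by pairs \<open>(j, u)\<close>: node
          \<open>i\<close> has one for each digit value \<open>u < w\<close>, and each non-helper in
          \<open>J\<close> has one digit sum, with dummy index \<open>0\<close>. \<open>X\<close>
          gives the Vandermonde nodes and \<open>V\<close> the unknowns.\<close>
        define J where "J = {0..<n} - insert i H"
        define U where "U = (\<lambda>j. if j = i then {..<w} else {0::nat})"
        \<comment> \<open>For \<open>j\<close> in \<open>J\<close> the parity coefficient does not
          see digit \<open>b\<close>, so the coordinate with digit \<open>0\<close> there represents
          all \<open>w\<close> of them.\<close>
        define X where "X = (\<lambda>(j, u). xi c w m j (if j = i then u else digit w m (put_digit w p 0 y) (j mod m)))"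
        define V where "V = (\<lambda>(j, u). if j = i then \<delta> i (put_digit w p u y) else \<Sum>v<w. \<delta> j (put_digit w p v y))"
        have put: "put_digit w p u y < N" if "u < w" for u
          using p that y by (simp add: N put_digit_less)
        have finJ: "finite J" and iJ: "i \<notin> J"
          by (auto simp: J_def)
        have J: "j < n" "j mod m \<noteq> b" "j \<noteq> i" if "j \<in> J" for j
          using that H(3) by (auto simp: J_def K_def)
        have finH: "finite H"
          using H(1) finite_subset by blast
        have "card (insert i H) = Suc d"
          using H finH by (subst card_insert_disjoint) auto
        moreover have "insert i H \<subseteq> {0..<n}"
          using H(1) i by auto
        ultimately have "card J = n - Suc d"
          using finH by (simp add: J_def card_Diff_subset)
        moreover have "(\<Sum>j\<in>J. card (U j)) = (\<Sum>j\<in>J. 1)"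
          using iJ by (intro sum.cong) (auto simp: U_def)
        then have "card (Sigma (insert i J) U) = w + card J"
          using finJ iJ by (subst card_SigmaI) (auto simp: U_def)
        \<comment> \<open>Since \<open>w < r\<close>, the truncated \<open>n - Suc d\<close> is
          exactly \<open>r - w\<close>, and the unknowns number \<open>w + (r - w)\<close>.\<close>
        ultimately have card: "card (Sigma (insert i J) U) = r"
          using d \<open>w < r\<close> by linarith
        have "V (i, u\<^sub>0) = 0"
        proof (rule vandermonde_kernel[where I = "Sigma (insert i J) U" and x = X])
          show "finite (Sigma (insert i J) U)"
            using finJ by (auto simp: U_def)
          show "card (Sigma (insert i J) U) \<le> r"
            by (simp add: card)
          show "(i, u\<^sub>0) \<in> Sigma (insert i J) U"
            using u\<^sub>0 by (simp add: U_def)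
          \<comment> \<open>Nodes in \<open>J\<close> lie outside the residue class of
            \<open>i\<close>, because \<open>K\<close> is contained in \<open>H\<close>; different
            residues already give different \<open>xi\<close>.\<close>
          have mixed: "xi c w m i u \<noteq> xi c w m j v" if "j \<in> J" for j u v
            using xi_eq_iff[OF params, of i j u v] J[OF that] i
            by (auto simp: \<open>n = s * m\<close> b_def)
          have "u = v" if "xi c w m i u = xi c w m i v" "u < w" "v < w" for u v
            using xi_inj_on_digit[OF params, of i] i that by (auto simp: inj_on_def \<open>n = s * m\<close>)
          moreover have "j = j'" if "j \<in> J" "j' \<in> J" "X (j, 0) = X (j', 0)" for j j'
            using inj[of "put_digit w p 0 y"] J[of j] J[of j'] that by (auto simp: inj_on_def X_def x_def)
          ultimately show "inj_on X (Sigma (insert i J) U)"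
            using mixed mixed[symmetric] J
            by (auto simp: inj_on_def U_def X_def split: if_splits)
        next
          fix t assume t: "t < r"
          \<comment> \<open>The contribution of node \<open>j\<close> to the \<open>t\<close>-th
            parity check summed over the \<open>w\<close> coordinates that differ only in digit
            \<open>b\<close>.\<close>
          define T where "T = (\<lambda>j. \<Sum>u<w. x j (put_digit w p u y) ^ t * \<delta> j (put_digit w p u y))"
          have T_other: "T j = x j (put_digit w p 0 y) ^ t * (\<Sum>u<w. \<delta> j (put_digit w p u y))"
            if "j mod m \<noteq> b" for j
          proof -
            have x_put: "x j (put_digit w p u y) = x j (put_digit w p 0 y)" if "u < w" for u
              using digit_put_digit_other[of b m "j mod m" w u y] b m w that \<open>j mod m \<noteq> b\<close>
              by (simp add: x_def p_def)
            show ?thesis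
              unfolding T_def sum_distrib_left
            proof (rule sum.cong)
              fix u assume "u \<in> {..<w}"
              then show "x j (put_digit w p u y) ^ t * \<delta> j (put_digit w p u y) =
                  x j (put_digit w p 0 y) ^ t * \<delta> j (put_digit w p u y)"
                using x_put[of u] by simp
            qed simp
          qed
          \<comment> \<open>Compulsory nodes contribute zero termwise, the other helpers because
            their digit sums vanish.\<close>
          have T_H: "T j = 0" if "j \<in> H" for j
          proof (cases "j \<in> K")
            case True
            then show ?thesis
              by (simp add: T_def dK)
          next
            case False
            then have "j mod m \<noteq> b"
              using that H(1) by (auto simp: K_def)
            then show ?thesis
              using False that y by (simp add: T_other dH)
          qed
          have x_i: "x i (put_digit w p u y) = xi c w m i u" if "u < w" for u
            unfolding x_def digit_def b_def[symmetric] p_def[symmetric]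
            by (simp add: put_digit_div_mod[OF p that])
          have T_i: "T i = (\<Sum>u\<in>U i. X (i, u) ^ t * V (i, u))"
            by (simp add: T_def U_def X_def V_def x_i)
          have T_J: "T j = (\<Sum>u\<in>U j. X (j, u) ^ t * V (j, u))" if "j \<in> J" for j
            using J[OF that] by (simp add: T_other U_def X_def V_def x_def)
          have "(\<Sum>z\<in>Sigma (insert i J) U. X z ^ t * V z) =
              (\<Sum>j\<in>insert i J. \<Sum>u\<in>U j. X (j, u) ^ t * V (j, u))"
            using finJ by (subst sum.Sigma) (auto simp: U_def case_prod_beta)
          also have "\<dots> = (\<Sum>j\<in>insert i J. T j)"
            using T_i T_J by (intro sum.cong) auto
          \<comment> \<open>The nodes missing from \<open>insert i J\<close> are the helpers, whose
            contributions are zero.\<close>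
          also have "\<dots> = (\<Sum>j<n. T j)"
            using i T_H by (intro sum.mono_neutral_left) (auto simp: J_def)
          also have "\<dots> = (\<Sum>u<w. \<Sum>j<n. x j (put_digit w p u y) ^ t * \<delta> j (put_digit w p u y))"
            unfolding T_def by (rule sum.swap)
          also have "\<dots> = 0"
            using t put parity by (intro sum.neutral) auto
          finally show "(\<Sum>z\<in>Sigma (insert i J) U. X z ^ t * V z) = 0" .
        qed
        then show ?thesis
          by (simp add: V_def)
      qed
      show "f i = f' i"
      proof (rule eq_vecI)
        fix a assume "a < dim_vec (f' i)"
        then have a: "a < q * w * p"
          using car[OF i] by (simp add: N)
        have "\<delta> i (put_digit w p (a div p mod w) (drop_digit w p a)) = 0"
          using w p a by (intro \<delta>_zero drop_digit_less) auto
        then show "f i $ a = f' i $ a"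
          using p by (simp add: put_drop_digit \<delta>_def)
      qed (use car[OF i] in auto)
    qed
    show "\<exists>K R. K \<subseteq> {0..<n} - {i} \<and> card K = d\<^sub>c \<and>
        (\<forall>j\<in>{0..<n} - {i}. dim_col (R j) = N \<and> full_rank (R j)) \<and>
        (\<forall>H. H \<subseteq> {0..<n} - {i} \<and> card H = d \<and> K \<subseteq> H \<longrightarrow>
           recoverable (array_code n k N A) i H R \<and>
           (\<Sum>j\<in>H. real (mat_rank (R j)))
             \<le> (1 + real d\<^sub>c * (real d - real k) / real d) *
               (real d / (real d - real k + 1)) * real N)"
      using K cardK full recover bandwidth by (intro exI[of _ K] exI[of _ R]) blast
  qed
qed

end
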